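(* Let $a<b$, $0\le\tau<b-a$, and consider Problem (P) as described in the context. If $x\in C^2([a-\tau,b],\mathbb{R})$ is a solution to Problem (P), then $x$ satisfies the following generalized Euler--Lagrange equations with time delay: $$ \lambda(t+\tau)\Bigl[\partial_4L[x,z]_\tau(t+\tau)-\frac{d}{dt}\partial_5L[x,z]_\tau(t+\tau)+\partial_5L[x,z]_\tau(t+\tau)\,\partial_6L[x,z]_\tau(t+\tau)\Bigr] $$ $$ +\lambda(t)\Bigl[\partial_2L[x,z]_\tau(t)-\frac{d}{dt}\partial_3L[x,z]_\tau(t)+\partial_3L[x,z]_\tau(t)\,\partial_6L[x,z]_\tau(t)\Bigr]=0,\qquad a\le t\le b-\tau, $$ where $\lambda(t):=e^{-\int_a^t\partial_6L[x,z]_\tau(\theta)\,d\theta}$, and $$ \partial_2L[x,z]_\tau(t)-\frac{d}{dt}\partial_3L[x,z]_\tau(t)+\partial_3L[x,z]_\tau(t)\,\partial_6L[x,z]_\tau(t)=0,\qquad b-\tau\le t\le b. $$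
   Context: Notation: $\partial_iL$ is the partial derivative of $L$ with respect to its $i$th argument, and $[x,z]_\tau(t):=(t,x(t),\dot x(t),x(t-\tau),\dot x(t-\tau),z(t))$; $\partial_iL[x,z]_\tau(t)$ is $\partial_iL$ evaluated at this point. Problem (P) (variational problem of Herglotz type with time delay): fix real numbers $\beta,\gamma$ and a function $\delta\in C^2([a-\tau,a],\mathbb{R})$. A function $x\in C^2([a-\tau,b],\mathbb{R})$ is admissible if $x(b)=\beta$ and $x(t)=\delta(t)$ for all $t\in[a-\tau,a]$. For such $x$, let $z=z\{x;\cdot\}_\tau$ denote the solution on $[a,b]$ of $$\dot z(t)=L\bigl(t,x(t),\dot x(t),x(t-\tau),\dot x(t-\tau),z(t)\bigr),\quad t\in[a,b],\qquad z(a)=\gamma .$$ The problem is to find the admissible functions $x$ that extremize (minimize or maximize) the value $z(b)=z\{x;b\}_\tau$; such an $x$ is a solution to Problem (P). The Lagrangian $L$ is assumed to satisfy: (i) $L\in C^1([a,b]\times\mathbb{R}^5,\mathbb{R})$; (ii) for $i=2,\dots,6$ the function $t\mapsto\partial_iL[x,z]_\tau(t)$ is differentiable for any admissible trajectory $x$.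
   Formalization: The second equation is asserted only for τ > 0; for τ = 0 its range is the single point t = b and the claim can fail there, e.g. a=0, b=1, L = ẋ(t)² + x(t) − x(t−τ), where the left side equals 1 for the affine minimizer. *)

theory Defs
  imports "HOL-Analysis.Analysis"
begin

(* Derivatives are taken within the closed domain, hence one-sided at end points; the library's
   C1_differentiable_on takes two-sided derivatives also at the end points. *)
definition C1_on :: "('a::real_normed_vector \<Rightarrow> 'b::real_normed_vector) \<Rightarrow> 'a set \<Rightarrow> bool" where
  "C1_on f S \<longleftrightarrow>
     (\<exists>f' :: 'a \<Rightarrow> 'a \<Rightarrow>\<^sub>L 'b.
        (\<forall>p\<in>S. (f has_derivative blinfun_apply (f' p)) (at p within S)) \<and> continuous_on S f')"

definition C2_on :: "(real \<Rightarrow> real) \<Rightarrow> real set \<Rightarrow> bool" where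
  "C2_on f S \<longleftrightarrow>
     (\<exists>f' f''. (\<forall>t\<in>S. (f has_real_derivative f' t) (at t within S)) \<and>
               (\<forall>t\<in>S. (f' has_real_derivative f'' t) (at t within S)) \<and>
               continuous_on S f'')"

(* The arguments (t, x, v, y, w, z) of a Lagrangian stand for
   time, state, velocity, delayed state, delayed velocity, and the Herglotz variable. *)
type_synonym point = "real \<times> real \<times> real \<times> real \<times> real \<times> real"

definition partial2 :: "(point \<Rightarrow> real) \<Rightarrow> point \<Rightarrow> real" where
  "partial2 L = (\<lambda>(t, x, v, y, w, z). deriv (\<lambda>s. L (t, s, v, y, w, z)) x)"

definition partial3 :: "(point \<Rightarrow> real) \<Rightarrow> point \<Rightarrow> real" where
  "partial3 L = (\<lambda>(t, x, v, y, w, z). deriv (\<lambda>s. L (t, x, s, y, w, z)) v)"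

definition partial4 :: "(point \<Rightarrow> real) \<Rightarrow> point \<Rightarrow> real" where
  "partial4 L = (\<lambda>(t, x, v, y, w, z). deriv (\<lambda>s. L (t, x, v, s, w, z)) y)"

definition partial5 :: "(point \<Rightarrow> real) \<Rightarrow> point \<Rightarrow> real" where
  "partial5 L = (\<lambda>(t, x, v, y, w, z). deriv (\<lambda>s. L (t, x, v, y, s, z)) w)"

definition partial6 :: "(point \<Rightarrow> real) \<Rightarrow> point \<Rightarrow> real" where
  "partial6 L = (\<lambda>(t, x, v, y, w, z). deriv (\<lambda>s. L (t, x, v, y, w, s)) z)"

(* The curve [x,z]_tau, for a trajectory x on the interval from a - tau to b. *)
definition delay_path ::
  "real \<Rightarrow> real \<Rightarrow> real \<Rightarrow> (real \<Rightarrow> real) \<Rightarrow> (real \<Rightarrow> real) \<Rightarrow> real \<Rightarrow> point" where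
  "delay_path a b \<tau> x z t =
     (t, x t, vector_derivative x (at t within {a - \<tau>..b}),
      x (t - \<tau>), vector_derivative x (at (t - \<tau>) within {a - \<tau>..b}), z t)"

definition admissible ::
  "real \<Rightarrow> real \<Rightarrow> real \<Rightarrow> real \<Rightarrow> (real \<Rightarrow> real) \<Rightarrow> (real \<Rightarrow> real) \<Rightarrow> bool" where
  "admissible a b \<tau> \<beta> \<delta> x \<longleftrightarrow>
     C2_on x {a - \<tau>..b} \<and> x b = \<beta> \<and> (\<forall>t\<in>{a - \<tau>..a}. x t = \<delta> t)"

(* z is the function z{x;.}_tau. For L of class C1 its restriction to {a..b} is unique, but
   it need not exist for every x, which is why it is a relation between x and z. *)
definition herglotz_ivp ::
  "real \<Rightarrow> real \<Rightarrow> real \<Rightarrow> real \<Rightarrow> (point \<Rightarrow> real) \<Rightarrow> (real \<Rightarrow> real) \<Rightarrow> (real \<Rightarrow> real) \<Rightarrow> bool" where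
  "herglotz_ivp a b \<tau> \<gamma> L x z \<longleftrightarrow>
     (\<forall>t\<in>{a..b}. (z has_real_derivative L (delay_path a b \<tau> x z t)) (at t within {a..b})) \<and>
     z a = \<gamma>"

definition minimizes_P ::
  "real \<Rightarrow> real \<Rightarrow> real \<Rightarrow> real \<Rightarrow> real \<Rightarrow> (real \<Rightarrow> real) \<Rightarrow> (point \<Rightarrow> real) \<Rightarrow> (real \<Rightarrow> real) \<Rightarrow> bool" where
  "minimizes_P a b \<tau> \<beta> \<gamma> \<delta> L x \<longleftrightarrow>
     (\<forall>z y w. herglotz_ivp a b \<tau> \<gamma> L x z \<and>
              admissible a b \<tau> \<beta> \<delta> y \<and> herglotz_ivp a b \<tau> \<gamma> L y w \<longrightarrow> z b \<le> w b)"

definition maximizes_P ::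
  "real \<Rightarrow> real \<Rightarrow> real \<Rightarrow> real \<Rightarrow> real \<Rightarrow> (real \<Rightarrow> real) \<Rightarrow> (point \<Rightarrow> real) \<Rightarrow> (real \<Rightarrow> real) \<Rightarrow> bool" where
  "maximizes_P a b \<tau> \<beta> \<gamma> \<delta> L x \<longleftrightarrow>
     (\<forall>z y w. herglotz_ivp a b \<tau> \<gamma> L x z \<and>
              admissible a b \<tau> \<beta> \<delta> y \<and> herglotz_ivp a b \<tau> \<gamma> L y w \<longrightarrow> w b \<le> z b)"

definition solution_P ::
  "real \<Rightarrow> real \<Rightarrow> real \<Rightarrow> real \<Rightarrow> real \<Rightarrow> (real \<Rightarrow> real) \<Rightarrow> (point \<Rightarrow> real) \<Rightarrow> (real \<Rightarrow> real) \<Rightarrow> bool" where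
  "solution_P a b \<tau> \<beta> \<gamma> \<delta> L x \<longleftrightarrow>
     admissible a b \<tau> \<beta> \<delta> x \<and> (\<exists>z. herglotz_ivp a b \<tau> \<gamma> L x z) \<and>
     (minimizes_P a b \<tau> \<beta> \<gamma> \<delta> L x \<or> maximizes_P a b \<tau> \<beta> \<gamma> \<delta> L x)"

definition discount ::
  "real \<Rightarrow> real \<Rightarrow> real \<Rightarrow> (point \<Rightarrow> real) \<Rightarrow> (real \<Rightarrow> real) \<Rightarrow> (real \<Rightarrow> real) \<Rightarrow> real \<Rightarrow> real" where
  "discount a b \<tau> L x z t = exp (- integral {a..t} (\<lambda>\<theta>. partial6 L (delay_path a b \<tau> x z \<theta>)))"

end

(* For a C^2 variation \<eta> vanishing on [a - \<tau>, a] and at b, let u = w - z, where w is the Herglotz variable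
   along x + s \<eta>. It solves an initial value problem whose right-hand side vanishes to first order in s,
   so for small s it exists on all of [a, b] (truncate in u, apply Picard's theorem, and note that the
   bound on u makes the truncation inactive). Multiplying by the integrating factor \<lambda> gives
   \<lambda>(b) u(b) = s J + o(s) with J linear in \<eta>; optimality fixes the sign of u(b), hence J = 0.
   The partial derivatives along the path are differentiable, but their derivatives need not be
   continuous, which rules out the fundamental lemma of the calculus of variations; the equations come
   instead from the du Bois-Reymond lemma, applied separately on [a, b - \<tau>] and [b - \<tau>, b] after shifting the
   delayed terms by \<tau>. *)
theory Submission
  imports Defs
begin

subsection \<open>Perturbed initial value problems\<close>

text \<open>The Lipschitz constant is valid for all \<open>u\<close>, so no blow-up can occur before
  \<open>b\<close>. The bound is linear in \<open>S\<close>, the size of the right-hand side at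
  \<open>u = 0\<close>; later this turns a defect of order \<open>s\<close> into a solution of order
  \<open>s\<close>.\<close>

lemma lipschitz_ivp_solution:
  fixes f :: "real \<Rightarrow> real \<Rightarrow> real"
  assumes "a \<le> b" and "0 < K"
    and cont: "continuous_on ({a..b} \<times> UNIV) (\<lambda>(t, u). f t u)"
    and lip: "\<And>t u v. t \<in> {a..b} \<Longrightarrow> \<bar>f t u - f t v\<bar> \<le> K * \<bar>u - v\<bar>"
    and bound: "\<And>t. t \<in> {a..b} \<Longrightarrow> \<bar>f t 0\<bar> \<le> S"
  obtains u where "u a = 0"
    and "\<And>t. t \<in> {a..b} \<Longrightarrow> (u has_real_derivative f t (u t)) (at t within {a..b})"
    and "\<And>t. t \<in> {a..b} \<Longrightarrow> \<bar>u t\<bar> \<le> 2 * (b - a) * exp (2 * K * (b - a)) * S"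
proof -
  \<comment> \<open>The rate is twice the Lipschitz constant: integrating \<open>K * E\<close> from
    \<open>a\<close> gives \<open>(E - 1) / 2\<close>, which produces the contraction factor
    1/2.\<close>
  define E where "E t = exp (2 * K * (t - a))" for t
  \<comment> \<open>The fixed point is sought among bounded continuous functions on the whole line;
    clamping time to \<open>{a..b}\<close> lets the operator act there.\<close>
  define c where "c t = max a (min b t)" for t
  define g where "g v t = f t (E t * apply_bcontfun v t)" for v :: "real \<Rightarrow>\<^sub>C real" and t
  (* The Picard operator conjugated by the weight E, which makes it a contraction on all of [a, b]. *)
  define h where "h v t = integral {a..c t} (g v) / E (c t)" for v t
  have E_pos: "0 < E t" for t by (simp add: E_def)
  have E_mono: "E s \<le> E t" if "s \<le> t" for s t using that \<open>0 < K\<close> by (simp add: E_def)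
  have E_a: "E a = 1" by (simp add: E_def)
  have c_in: "c t \<in> {a..b}" for t using \<open>a \<le> b\<close> by (auto simp: c_def)
  have c_id: "c t = t" if "t \<in> {a..b}" for t using that by (auto simp: c_def)
  have cont_E: "continuous_on T E" for T unfolding E_def by (intro continuous_intros)
  have cont_f: "continuous_on {a..b} (\<lambda>t. f t (w t))" if "continuous_on {a..b} w" for w
  proof -
    have "continuous_on {a..b} (\<lambda>t. (t, w t))" by (intro continuous_intros that)
    from continuous_on_compose2[OF cont this] show ?thesis by auto
  qed
  have cont_g: "continuous_on {a..b} (g v)" for v
    unfolding g_def by (intro cont_f continuous_intros cont_E) auto
  have int_g: "g v integrable_on {a..t}" if "t \<in> {a..b}" for v t
    using that by (intro integrable_continuous_real continuous_on_subset[OF cont_g]) auto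
  have cont_q: "continuous_on {a..b} (\<lambda>t. integral {a..t} (g v) / E t)" for v
    using E_pos by (intro continuous_intros indefinite_integral_continuous_1 int_g cont_E)
      (auto simp: less_imp_neq[symmetric] \<open>a \<le> b\<close>)
  have cont_c: "continuous_on UNIV c" unfolding c_def by (intro continuous_intros)
  have h_bcont: "h v \<in> bcontfun" for v
  proof -
    have "continuous_on UNIV (h v)"
      unfolding h_def using continuous_on_compose2[OF cont_q cont_c, of v] c_in by blast
    moreover have "range (h v) \<subseteq> (\<lambda>t. integral {a..t} (g v) / E t) ` {a..b}"
      using c_in by (auto simp: h_def)
    then have "bounded (range (h v))"
      using compact_imp_bounded[OF compact_continuous_image[OF cont_q compact_Icc]] bounded_subset
      by blast
    ultimately show ?thesis by (simp add: bcontfun_def)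
  qed
  define T where "T v = Bcontfun (h v)" for v
  have T: "apply_bcontfun (T v) = h v" for v
    using h_bcont by (simp add: T_def Bcontfun_inverse)
  have int_E: "((\<lambda>s. D * (K * E s)) has_integral D / 2 * (E t - 1)) {a..t}" if "a \<le> t" for D t
  proof -
    have "((\<lambda>s. D / 2 * E s) has_vector_derivative D * (K * E s)) (at s within {a..t})" for s
      unfolding E_def has_real_derivative_iff_has_vector_derivative[symmetric]
      by (auto intro!: derivative_eq_intros)
    from fundamental_theorem_of_calculus[OF that this] show ?thesis
      by (simp add: E_a algebra_simps diff_divide_distrib)
  qed
  have contraction: "dist (T v) (T w) \<le> 1 / 2 * dist v w" for v w
  proof (rule dist_bound)
    fix t
    let ?D = "dist v w" and ?t = "c t"
    have "a \<le> ?t" "?t \<le> b" using c_in[of t] by auto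
    have "\<bar>integral {a..?t} (\<lambda>s. g v s - g w s)\<bar> \<le> ?D / 2 * (E ?t - 1)"
    proof -
      have "norm (integral {a..?t} (\<lambda>s. g v s - g w s)) \<le> integral {a..?t} (\<lambda>s. ?D * (K * E s))"
      proof (rule integral_norm_bound_integral)
        show "(\<lambda>s. g v s - g w s) integrable_on {a..?t}"
          by (intro integrable_diff int_g c_in)
        show "(\<lambda>s. ?D * (K * E s)) integrable_on {a..?t}"
          using int_E[OF \<open>a \<le> ?t\<close>] by blast
        fix s assume "s \<in> {a..?t}"
        then have "s \<in> {a..b}" using \<open>?t \<le> b\<close> by auto
        have "\<bar>g v s - g w s\<bar> \<le> K * \<bar>E s * v s - E s * w s\<bar>"
          unfolding g_def by (rule lip[OF \<open>s \<in> {a..b}\<close>])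
        also have "\<dots> = K * E s * dist (v s) (w s)"
          using E_pos[of s] by (simp add: dist_real_def abs_mult flip: right_diff_distrib)
        also have "\<dots> \<le> K * E s * ?D"
          using E_pos[of s] \<open>0 < K\<close> by (intro mult_left_mono dist_bounded) auto
        finally show "norm (g v s - g w s) \<le> ?D * (K * E s)" by (simp add: mult.commute)
      qed
      also have "\<dots> = ?D / 2 * (E ?t - 1)" using int_E[OF \<open>a \<le> ?t\<close>] by (rule integral_unique)
      finally show ?thesis by simp
    qed
    also have "\<dots> \<le> ?D / 2 * E ?t" by (intro mult_left_mono) auto
    finally have "\<bar>integral {a..?t} (g v) - integral {a..?t} (g w)\<bar> \<le> ?D / 2 * E ?t"
      using integral_diff[OF int_g[OF c_in[of t], of v] int_g[OF c_in[of t], of w]] by simp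
    then show "dist (T v t) (T w t) \<le> 1 / 2 * dist v w"
      using E_pos[of ?t] by (simp add: T h_def dist_real_def field_simps flip: diff_divide_distrib)
  qed
  then obtain v where v: "T v = v"
    using banach_fix_type[of "1/2" T] by auto
  have S: "0 \<le> S" using bound[of a] \<open>a \<le> b\<close> by force
  have "norm (T 0) \<le> (b - a) * S"
  proof (rule norm_bound)
    fix t
    have t: "a \<le> c t" "c t \<le> b" using c_in[of t] by auto
    have "\<bar>integral {a..c t} (g 0)\<bar> \<le> S * (c t - a)"
      using integral_bound[OF t(1) continuous_on_subset[OF cont_g], of 0 S] t bound
      by (simp add: g_def)
    also have "\<dots> \<le> S * (b - a)" using S t by (intro mult_left_mono) auto
    also have "\<dots> \<le> S * (b - a) * E (c t)"
      using mult_left_mono[OF E_mono[OF t(1)], of "S * (b - a)"] S \<open>a \<le> b\<close> by (simp add: E_a)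
    finally show "norm (T 0 t) \<le> (b - a) * S"
      using E_pos[of "c t"] by (simp add: T h_def divide_le_eq mult.commute)
  qed
  \<comment> \<open>Since \<open>v = T v\<close>, comparing \<open>v\<close> with 0 under the
    contraction absorbs half of \<open>norm v\<close>. This is the factor 2 in the final bound; the
    exponential there is the weight \<open>E\<close> at \<open>b\<close>.\<close>
  moreover have "norm v \<le> norm (T 0) + 1 / 2 * norm v"
    using contraction[of v 0] norm_triangle_ineq[of "T v - T 0" "T 0"] by (simp add: v dist_norm)
  ultimately have "norm v \<le> 2 * ((b - a) * S)" by linarith
  then have norm_v: "norm v \<le> 2 * (b - a) * S" by (simp only: mult.assoc)
  define u where "u t = E t * v t" for t
  have u_eq: "u t = integral {a..t} (\<lambda>s. f s (u s))" if "t \<in> {a..b}" for t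
  proof -
    have "u t = E t * h v t" using v T[of v] by (simp add: u_def)
    then show ?thesis using c_id[OF that] E_pos[of t] by (simp add: h_def g_def[abs_def] u_def)
  qed
  show ?thesis
  proof
    show "u a = 0" using u_eq[of a] \<open>a \<le> b\<close> by simp
  next
    fix t assume t: "t \<in> {a..b}"
    have "continuous_on {a..b} u" unfolding u_def by (intro continuous_intros cont_E) auto
    from integral_has_real_derivative[OF cont_f[OF this] t]
    show "(u has_real_derivative f t (u t)) (at t within {a..b})"
      by (rule has_field_derivative_transform_within[OF _ zero_less_one t]) (simp add: u_eq)
    have "\<bar>u t\<bar> = E t * norm (v t)" using E_pos[of t] by (simp add: u_def abs_mult)
    also have "\<dots> \<le> E b * (2 * (b - a) * S)"
      using t E_pos[of b] E_mono[of t b] norm_bounded[of v t] norm_v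
      by (intro mult_mono) auto
    finally show "\<bar>u t\<bar> \<le> 2 * (b - a) * exp (2 * K * (b - a)) * S"
      by (simp add: E_def mult_ac)
  qed
qed

text \<open>Here \<open>d\<close> is a variation, \<open>e\<close> the direction of the Herglotz
  variable and \<open>u\<close> the change of that variable. The linearized equation is u' = P u + s
  Q with P and Q the derivatives of \<open>L\<close> along \<open>e\<close> and \<open>d\<close>,
  and \<open>l\<close> is its integrating factor, so to first order \<open>l b * u b\<close> is
  \<open>s\<close> times an integral free of \<open>u\<close>.\<close>

lemma perturbed_ivp:
  fixes L :: "'a::euclidean_space \<Rightarrow> real" and L' :: "'a \<Rightarrow> 'a \<Rightarrow>\<^sub>L real"
    and p d :: "real \<Rightarrow> 'a" and e :: 'a
  assumes "a < b" and "closed S" and "convex S"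
    and L: "\<And>q. q \<in> S \<Longrightarrow> (L has_derivative L' q) (at q within S)"
    and cont_L': "continuous_on S L'"
    and cont_p: "continuous_on {a..b} p" and cont_d: "continuous_on {a..b} d"
    and in_S: "\<And>t s r. t \<in> {a..b} \<Longrightarrow> p t + s *\<^sub>R d t + r *\<^sub>R e \<in> S"
    and "0 < \<epsilon>"
  defines "l \<equiv> \<lambda>t. exp (- integral {a..t} (\<lambda>\<theta>. L' (p \<theta>) e))"
  obtains \<delta> where "0 < \<delta>" and "\<And>s. \<bar>s\<bar> < \<delta> \<Longrightarrow> \<exists>u. u a = 0 \<and>
    (\<forall>t\<in>{a..b}. (u has_real_derivative L (p t + s *\<^sub>R d t + u t *\<^sub>R e) - L (p t)) (at t within {a..b})) \<and>
    \<bar>l b * u b - s * integral {a..b} (\<lambda>t. l t * L' (p t) (d t))\<bar> \<le> \<epsilon> * \<bar>s\<bar>"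
proof -
  have p_in: "p t \<in> S" if "t \<in> {a..b}" for t
    using in_S[OF that, of 0 0] by simp
  have cont_L: "continuous_on S L"
    using L by (rule has_derivative_continuous_on)
  have "bounded ((\<lambda>t. norm (p t) + norm (d t) + norm e) ` {a..b})"
    by (intro compact_imp_bounded compact_continuous_image continuous_intros cont_p cont_d compact_Icc)
  then obtain R where "0 < R" and "\<forall>t\<in>{a..b}. norm (norm (p t) + norm (d t) + norm e) \<le> R"
    unfolding bounded_pos by auto
  then have R: "norm (p t) + norm (d t) + norm e \<le> R" if "t \<in> {a..b}" for t
    using that by fastforce
  \<comment> \<open>A compact convex set containing all arguments of \<open>L\<close> that occur for
    |s|, |u| \<le> 1; on it \<open>L'\<close> is bounded and uniformly continuous, and
    \<open>L\<close> is Lipschitz.\<close>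
  define N where "N = S \<inter> cball 0 R"
  have "compact N" unfolding N_def using \<open>closed S\<close> by (simp add: closed_Int_compact)
  have "convex N" unfolding N_def using \<open>convex S\<close> by (simp add: convex_Int)
  have L_N: "(L has_derivative L' q) (at q within N)" if "q \<in> N" for q
    using that by (intro has_derivative_subset[OF L]) (auto simp: N_def)
  have cont_N: "continuous_on N L'" using cont_L' by (rule continuous_on_subset) (simp add: N_def)
  have in_N: "p t + s *\<^sub>R d t + r *\<^sub>R e \<in> N" if "t \<in> {a..b}" "\<bar>s\<bar> \<le> 1" "\<bar>r\<bar> \<le> 1" for t s r
  proof -
    have "norm (s *\<^sub>R d t) \<le> norm (d t)" "norm (r *\<^sub>R e) \<le> norm e"
      using that by (auto simp: mult_left_le_one_le)
    then have "norm (p t + s *\<^sub>R d t + r *\<^sub>R e) \<le> R"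
      using R[OF that(1)] norm_triangle_ineq[of "p t + s *\<^sub>R d t" "r *\<^sub>R e"]
        norm_triangle_ineq[of "p t" "s *\<^sub>R d t"] by linarith
    then show ?thesis using in_S[OF that(1)] by (simp add: N_def)
  qed
  obtain K where "0 < K" and K: "\<And>q. q \<in> N \<Longrightarrow> norm (L' q) \<le> K"
    using compact_imp_bounded[OF compact_continuous_image[OF cont_N \<open>compact N\<close>]]
    unfolding bounded_pos by auto
  have L_lip: "\<bar>L q - L q'\<bar> \<le> K * norm (q - q')" if "q \<in> N" "q' \<in> N" for q q'
    using differentiable_bound[OF \<open>convex N\<close> L_N _ that, of K] K by (simp add: norm_blinfun.rep_eq)

  \<comment> \<open>Truncation at 1 makes the right-hand side globally Lipschitz in \<open>u\<close>
    and keeps its arguments in \<open>N\<close> while |s| \<le> 1.\<close>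
  define cl where "cl u = max (- 1) (min 1 u)" for u :: real
  have cl: "\<bar>cl u\<bar> \<le> 1" "\<bar>cl u - cl v\<bar> \<le> \<bar>u - v\<bar>" for u v
    by (auto simp: cl_def)
  define f where "f s t u = L (p t + s *\<^sub>R d t + cl u *\<^sub>R e) - L (p t)" for s t u
  \<comment> \<open>The summand 1 keeps the Lipschitz constant positive even when
    \<open>e = 0\<close>.\<close>
  define K1 where "K1 = K * norm e + 1"
  have "0 < K1" using \<open>0 < K\<close> by (simp add: K1_def add_nonneg_pos)
  \<comment> \<open>The a priori bound of the Picard lemma, with
    \<open>K * R * \<bar>s\<bar>\<close> for the size at \<open>u = 0\<close>, reads |u t| \<le> C
    |s|. Once C |s| \<le> 1 the truncation is inactive.\<close>
  define C where "C = 2 * (b - a) * exp (2 * K1 * (b - a)) * (K * R)"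
  have "0 \<le> C" using \<open>a < b\<close> \<open>0 < K\<close> \<open>0 < R\<close> by (simp add: C_def)
  have solvable: "\<exists>u. u a = 0 \<and> (\<forall>t\<in>{a..b}. \<bar>u t\<bar> \<le> C * \<bar>s\<bar> \<and>
      (u has_real_derivative L (p t + s *\<^sub>R d t + u t *\<^sub>R e) - L (p t)) (at t within {a..b}))"
    if s: "\<bar>s\<bar> \<le> 1" "C * \<bar>s\<bar> \<le> 1" for s
  proof -
    have cont: "continuous_on ({a..b} \<times> UNIV) (\<lambda>(t, u). f s t u)"
    proof -
      have fst: "continuous_on ({a..b} \<times> UNIV) (\<lambda>x. w (fst x))"
        if "continuous_on {a..b} w" for w :: "real \<Rightarrow> 'a"
        by (rule continuous_on_compose2[OF that continuous_on_fst[OF continuous_on_id]]) auto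
      show ?thesis unfolding f_def cl_def case_prod_beta
        by (intro continuous_intros continuous_on_compose2[OF cont_L] fst cont_p cont_d)
          (use in_S p_in in auto)
    qed
    have lip: "\<bar>f s t u - f s t v\<bar> \<le> K1 * \<bar>u - v\<bar>" if "t \<in> {a..b}" for t u v
    proof -
      have "\<bar>f s t u - f s t v\<bar> \<le> K * norm ((cl u - cl v) *\<^sub>R e)"
        using L_lip[OF in_N[OF that s(1) cl(1)[of u]] in_N[OF that s(1) cl(1)[of v]]]
        by (simp add: f_def scaleR_diff_left)
      also have "\<dots> \<le> K * (\<bar>u - v\<bar> * norm e)"
        unfolding norm_scaleR using \<open>0 < K\<close> cl(2) by (intro mult_left_mono mult_right_mono) auto
      also have "\<dots> \<le> K1 * \<bar>u - v\<bar>" by (simp add: K1_def algebra_simps)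
      finally show ?thesis .
    qed
    have at_0: "\<bar>f s t 0\<bar> \<le> K * R * \<bar>s\<bar>" if "t \<in> {a..b}" for t
    proof -
      have "\<bar>f s t 0\<bar> \<le> K * norm (s *\<^sub>R d t)"
        using L_lip[OF in_N[OF that s(1), of 0] in_N[OF that, of 0 0]]
        by (simp add: f_def cl_def)
      also have "\<dots> \<le> K * (\<bar>s\<bar> * R)"
        unfolding norm_scaleR using \<open>0 < K\<close> R[OF that] norm_ge_zero[of "p t"] norm_ge_zero[of e]
        by (intro mult_left_mono) linarith+
      finally show ?thesis by (simp add: mult_ac)
    qed
    from lipschitz_ivp_solution[OF less_imp_le[OF \<open>a < b\<close>] \<open>0 < K1\<close> cont lip at_0]
    obtain u where u: "u a = 0"
      "\<And>t. t \<in> {a..b} \<Longrightarrow> (u has_real_derivative f s t (u t)) (at t within {a..b})"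
      "\<And>t. t \<in> {a..b} \<Longrightarrow> \<bar>u t\<bar> \<le> C * \<bar>s\<bar>"
      unfolding C_def by (auto simp: mult_ac)
    have "cl (u t) = u t" if "t \<in> {a..b}" for t
      using u(3)[OF that] s(2) by (auto simp: cl_def)
    then show ?thesis using u by (auto simp: f_def)
  qed

  \<comment> \<open>Integrating factor of the linearized equation\<close>
  define P where "P t = L' (p t) e" for t
  define Q where "Q t = L' (p t) (d t)" for t
  have cont_L'p: "continuous_on {a..b} (\<lambda>t. L' (p t))"
    by (rule continuous_on_compose2[OF cont_L' cont_p]) (use p_in in auto)
  have cont_P: "continuous_on {a..b} P" and cont_Q: "continuous_on {a..b} Q"
    unfolding P_def Q_def by (intro continuous_intros cont_L'p cont_d)+
  define I where "I t = integral {a..t} P" for t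
  have I: "(I has_real_derivative P t) (at t within {a..b})" if "t \<in> {a..b}" for t
    unfolding I_def by (rule integral_has_real_derivative[OF cont_P that])
  have l_eq: "l = (\<lambda>t. exp (- I t))" by (simp add: l_def I_def P_def[abs_def])
  have l_deriv: "(l has_real_derivative - P t * l t) (at t within {a..b})" if "t \<in> {a..b}" for t
    unfolding l_eq using I[OF that] by (auto intro!: derivative_eq_intros)
  then have cont_l: "continuous_on {a..b} l" by (rule DERIV_continuous_on)
  define m where "m t = integral {a..t} (\<lambda>t. l t * Q t)" for t
  have m_deriv: "(m has_real_derivative l t * Q t) (at t within {a..b})"
    if "t \<in> {a..b}" for t
    unfolding m_def by (intro integral_has_real_derivative that continuous_intros cont_l cont_Q)
  obtain M where "0 < M" and M: "\<And>t. t \<in> {a..b} \<Longrightarrow> \<bar>l t\<bar> \<le> M"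
    using compact_imp_bounded[OF compact_continuous_image[OF cont_l compact_Icc]]
    unfolding bounded_pos by auto

  define B where "B = R * (1 + C)"
  have "0 < B" using \<open>0 < R\<close> \<open>0 \<le> C\<close> by (simp add: B_def)
  \<comment> \<open>\<open>B * \<bar>s\<bar>\<close> is going to bound the displacement s d + u e.
    The value of \<eta> is chosen to make the final error M (B |s| \<eta>) (b - a) equal to
    \<epsilon> |s|.\<close>
  define \<eta> where "\<eta> = \<epsilon> / (M * B * (b - a))"
  have "0 < \<eta>" using \<open>0 < \<epsilon>\<close> \<open>0 < M\<close> \<open>0 < B\<close> \<open>a < b\<close> by (simp add: \<eta>_def)
  obtain \<rho> where "0 < \<rho>" and \<rho>: "\<And>q q'. \<lbrakk>q \<in> N; q' \<in> N; dist q' q < \<rho>\<rbrakk> \<Longrightarrow> dist (L' q') (L' q) < \<eta>"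
    using compact_uniformly_continuous[OF cont_N \<open>compact N\<close>] \<open>0 < \<eta>\<close>
    unfolding uniformly_continuous_on_def by blast
  \<comment> \<open>In turn, the three bounds keep the perturbed points in \<open>N\<close>, make
    the truncation inactive (with C + 1, as C may be 0), and keep the displacement below
    \<rho>.\<close>
  define \<delta> where "\<delta> = Min {1, 1 / (C + 1), \<rho> / B}"
  have "0 < \<delta>" using \<open>0 \<le> C\<close> \<open>0 < \<rho>\<close> \<open>0 < B\<close> by (simp add: \<delta>_def)
  show ?thesis
  proof (rule that[OF \<open>0 < \<delta>\<close>])
    fix s :: real
    assume "\<bar>s\<bar> < \<delta>"
    then have s: "\<bar>s\<bar> \<le> 1" "(C + 1) * \<bar>s\<bar> \<le> 1" "B * \<bar>s\<bar> < \<rho>"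
      using \<open>0 \<le> C\<close> \<open>0 < B\<close> by (auto simp: \<delta>_def field_simps)
    then have "C * \<bar>s\<bar> \<le> 1" by (simp add: algebra_simps)
    from solvable[OF s(1) this] obtain u where u0: "u a = 0"
      and u_le: "\<And>t. t \<in> {a..b} \<Longrightarrow> \<bar>u t\<bar> \<le> C * \<bar>s\<bar>"
      and u: "\<And>t. t \<in> {a..b} \<Longrightarrow>
        (u has_real_derivative L (p t + s *\<^sub>R d t + u t *\<^sub>R e) - L (p t)) (at t within {a..b})"
      by blast
    define w where "w t = L (p t + s *\<^sub>R d t + u t *\<^sub>R e) - L (p t) - (s * Q t + u t * P t)" for t
    have w: "\<bar>w t\<bar> \<le> B * \<bar>s\<bar> * \<eta>" if t: "t \<in> {a..b}" for t
    proof -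
      let ?k = "s *\<^sub>R d t + u t *\<^sub>R e" and ?N = "closed_segment (p t) (p t + s *\<^sub>R d t + u t *\<^sub>R e)"
      have "norm ?k \<le> \<bar>s\<bar> * R + (C * \<bar>s\<bar>) * R"
      proof (rule norm_triangle_le, rule add_mono)
        show "norm (s *\<^sub>R d t) \<le> \<bar>s\<bar> * R" unfolding norm_scaleR
          using R[OF t] norm_ge_zero[of "p t"] norm_ge_zero[of e] by (intro mult_left_mono) linarith+
        show "norm (u t *\<^sub>R e) \<le> (C * \<bar>s\<bar>) * R" unfolding norm_scaleR
          using R[OF t] norm_ge_zero[of "p t"] norm_ge_zero[of "d t"] u_le[OF t]
            abs_ge_zero[of "u t"] norm_ge_zero[of e] by (intro mult_mono) linarith+
      qed
      then have k: "norm ?k \<le> B * \<bar>s\<bar>" by (simp add: B_def algebra_simps)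
      have ends: "p t \<in> N" "p t + s *\<^sub>R d t + u t *\<^sub>R e \<in> N"
        using in_N[OF t, of 0 0] in_N[OF t s(1), of "u t"] u_le[OF t] \<open>C * \<bar>s\<bar> \<le> 1\<close> by auto
      then have sub: "?N \<subseteq> N" using \<open>convex N\<close> by (simp add: closed_segment_subset)
      \<comment> \<open>Mean value inequality for \<open>L\<close> minus its linearization at
        \<open>p t\<close>, used on the segment alone: there \<open>L'\<close> differs from
        \<open>L' (p t)\<close> by less than \<eta>.\<close>
      have "norm (L (p t + s *\<^sub>R d t + u t *\<^sub>R e) - L (p t) - L' (p t) (p t + s *\<^sub>R d t + u t *\<^sub>R e - p t))
          \<le> norm (p t + s *\<^sub>R d t + u t *\<^sub>R e - p t) * \<eta>"
      proof (rule differentiable_bound_linearization[where S = ?N and f' = "\<lambda>q. blinfun_apply (L' q)"])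
        show "p t + r *\<^sub>R (p t + s *\<^sub>R d t + u t *\<^sub>R e - p t) \<in> ?N" if "r \<in> {0..1}" for r
          using that by (auto simp: in_segment algebra_simps intro!: exI[of _ r])
        fix q assume q: "q \<in> ?N"
        with sub show "(L has_derivative L' q) (at q within ?N)"
          using has_derivative_subset[OF L_N] by blast
        have "dist q (p t) \<le> norm ?k"
          using q dist_in_closed_segment[OF q] by (simp add: dist_norm norm_minus_commute add_ac)
        then have "dist q (p t) < \<rho>" using k s(3) by simp
        then have "dist (L' q) (L' (p t)) < \<eta>" using \<rho>[OF ends(1)] q sub by blast
        then show "onorm (blinfun_apply (L' q) - blinfun_apply (L' (p t))) \<le> \<eta>"
          by (simp add: dist_norm norm_blinfun.rep_eq minus_blinfun.rep_eq fun_diff_def)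
      qed simp
      also have "L' (p t) (p t + s *\<^sub>R d t + u t *\<^sub>R e - p t) = s * Q t + u t * P t"
        by (simp add: blinfun.add_right blinfun.scaleR_right P_def Q_def add.assoc)
      also have "norm (p t + s *\<^sub>R d t + u t *\<^sub>R e - p t) * \<eta> \<le> B * \<bar>s\<bar> * \<eta>"
        using k \<open>0 < \<eta>\<close> by (simp add: add.assoc mult_right_mono)
      finally show ?thesis by (simp add: w_def)
    qed
    \<comment> \<open>In the derivative of \<Phi>, l' = - P l cancels the term u P and m' cancels s
      Q, so only l times the remainder \<open>w\<close> survives. Moreover \<Phi> vanishes at
      \<open>a\<close>.\<close>
    define \<Phi> where "\<Phi> t = l t * u t - s * m t" for t
    have \<Phi>': "(\<Phi> has_real_derivative l t * w t) (at t within {a..b})" if "t \<in> {a..b}" for t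
      unfolding \<Phi>_def w_def
      using l_deriv[OF that] u[OF that] m_deriv[OF that]
      by (auto intro!: derivative_eq_intros simp: algebra_simps)
    have "norm (\<Phi> b - \<Phi> a) \<le> M * (B * \<bar>s\<bar> * \<eta>) * norm (b - a)"
    proof (rule field_differentiable_bound[OF convex_real_interval(5) \<Phi>'])
      show "norm (l t * w t) \<le> M * (B * \<bar>s\<bar> * \<eta>)" if "t \<in> {a..b}" for t
        unfolding norm_mult using M[OF that] w[OF that] \<open>0 < M\<close> by (intro mult_mono) auto
    qed (use \<open>a < b\<close> in auto)
    also have "\<dots> = \<epsilon> * \<bar>s\<bar>"
      using \<open>a < b\<close> \<open>0 < M\<close> \<open>0 < B\<close> by (simp add: \<eta>_def)
    finally have "\<bar>l b * u b - s * integral {a..b} (\<lambda>t. l t * L' (p t) (d t))\<bar> \<le> \<epsilon> * \<bar>s\<bar>"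
      by (simp add: \<Phi>_def u0 m_def Q_def)
    with u0 u show "\<exists>u. u a = 0 \<and>
      (\<forall>t\<in>{a..b}. (u has_real_derivative L (p t + s *\<^sub>R d t + u t *\<^sub>R e) - L (p t)) (at t within {a..b})) \<and>
      \<bar>l b * u b - s * integral {a..b} (\<lambda>t. l t * L' (p t) (d t))\<bar> \<le> \<epsilon> * \<bar>s\<bar>"
      by blast
  qed
qed

subsection \<open>The du Bois-Reymond lemma\<close>

lemma trunc_power_has_derivative:
  fixes s :: real
  assumes "1 \<le> n"
  shows "((\<lambda>s. max 0 s ^ Suc n) has_real_derivative of_nat (Suc n) * max 0 s ^ n) (at s)"
proof (cases s "0::real" rule: linorder_cases)
  case less
  have "((\<lambda>_. 0) has_real_derivative 0) (at s)" by simp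
  then have "((\<lambda>s. max 0 s ^ Suc n) has_real_derivative 0) (at s)"
    by (rule has_field_derivative_transform_within_open[of _ _ _ "{..<0}"]) (use less in auto)
  then show ?thesis using less assms by (simp add: power_0_left)
next
  case equal
  \<comment> \<open>At the kink the difference quotient is dominated by \<open>max 0 h ^ n\<close>,
    which tends to 0 because n is at least 1.\<close>
  have "((\<lambda>h. max 0 h ^ Suc n / h) \<longlongrightarrow> 0) (at (0::real))"
  proof (rule Lim_null_comparison)
    have "norm (max 0 h ^ Suc n / h) \<le> max 0 h ^ n" for h :: real
      by (cases "h \<le> 0") auto
    then show "\<forall>\<^sub>F h in at 0. norm (max 0 h ^ Suc n / h) \<le> max 0 h ^ n" by simp
    have "isCont (\<lambda>h::real. max 0 h ^ n) 0" by (intro continuous_intros)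
    moreover have "max 0 (0::real) ^ n = 0" using assms by (simp add: power_0_left)
    ultimately show "((\<lambda>h. max 0 h ^ n) \<longlongrightarrow> 0) (at (0::real))"
      by (simp only: isCont_def)
  qed
  then show ?thesis using equal assms by (simp add: has_field_derivative_iff power_0_left)
next
  case greater
  have "((\<lambda>s. s ^ Suc n) has_real_derivative of_nat (Suc n) * s ^ n) (at s)"
    by (rule DERIV_cong[OF DERIV_pow]) simp
  then have "((\<lambda>s. max 0 s ^ Suc n) has_real_derivative of_nat (Suc n) * s ^ n) (at s)"
    by (rule has_field_derivative_transform_within_open[of _ _ _ "{0<..}"]) (use greater in auto)
  then show ?thesis using greater by simp
qed

text \<open>Third differences of truncated powers: up to a factor, \<open>spline 2 h\<close> is the quadratic B-spline,
  a C1 bump supported on [0, 3h], and \<open>spline 3 h\<close> is its primitive.\<close>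

definition spline :: "nat \<Rightarrow> real \<Rightarrow> real \<Rightarrow> real" where
  "spline n h s = max 0 s ^ n - 3 * max 0 (s - h) ^ n + 3 * max 0 (s - 2 * h) ^ n
     - max 0 (s - 3 * h) ^ n"

lemma spline_has_derivative:
  assumes "1 \<le> n"
  shows "((\<lambda>t. spline (Suc n) h (t - p)) has_real_derivative of_nat (Suc n) * spline n h (t - p)) (at t)"
proof -
  have shift: "((\<lambda>t. max 0 (t - q) ^ Suc n) has_real_derivative of_nat (Suc n) * max 0 (t - q) ^ n) (at t)"
    for q
    using trunc_power_has_derivative[OF assms, of "t - q"]
      DERIV_shift[of "\<lambda>s. max 0 s ^ Suc n" _ t "- q"] by simp
  show ?thesis
    unfolding spline_def diff_diff_eq
    by (rule derivative_eq_intros shift refl)+ (simp add: algebra_simps)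
qed

lemma spline_left: "spline n h s = 0" if "s \<le> 0" "0 < h" "0 < n"
  using that by (simp add: spline_def)

text \<open>Past the last knot no truncation is active, which leaves the third difference of a
  cubic, the constant 3! h^3. Being independent of \<open>s\<close>, it cancels in the difference of
  two translates.\<close>

lemma spline3_right: "spline 3 h s = 6 * h ^ 3" if "3 * h \<le> s" "0 < h"
  using that by (simp add: spline_def eval_nat_numeral) (simp add: algebra_simps)

lemma spline2_right: "spline 2 h s = 0" if "3 * h \<le> s" "0 < h"
  using that by (simp add: spline_def eval_nat_numeral) (simp add: algebra_simps)

lemma spline2_nonneg: "0 \<le> spline 2 h s" if "0 < h"
proof -
  consider "s \<le> h" | "h \<le> s" "s \<le> 2 * h" | "2 * h \<le> s" "s \<le> 3 * h" | "3 * h \<le> s" by linarith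
  then show ?thesis
  proof cases
    case 1
    then show ?thesis using that by (simp add: spline_def)
  next
    case 2
    \<comment> \<open>The middle piece is a concave quadratic with value \<open>h * h\<close> at
      both \<open>s = h\<close> and \<open>s = 2 * h\<close>; subtracting this value leaves a
      product of nonnegative factors.\<close>
    have "0 \<le> (s - h) * (2 * h - s)" using 2 by simp
    moreover have "0 < h * h" using that by simp
    moreover have "spline 2 h s = 2 * ((s - h) * (2 * h - s)) + h * h"
      using 2 that by (simp add: spline_def power2_eq_square) (simp add: algebra_simps)
    ultimately show ?thesis by linarith
  next
    case 3
    then have "spline 2 h s = (3 * h - s)\<^sup>2"
      using that by (simp add: spline_def power2_eq_square) (simp add: algebra_simps)
    then show ?thesis by simp
  next
    case 4
    then show ?thesis using that by (simp add: spline2_right)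
  qed
qed

lemma continuous_on_spline: "continuous_on T (\<lambda>t. spline n h (t - p))"
  unfolding spline_def by (intro continuous_intros)

text \<open>With F a primitive of \<open>A\<close>, integration by parts turns \<open>weak\<close>
  into orthogonality of B - F to every \<eta>', which forces B - F to be constant; differentiability
  of \<open>B\<close> is thus a result. Test functions vanish outside the interval together with
  their derivative, so they can serve as variations on a larger one.\<close>

lemma du_bois_reymond:
  fixes A B :: "real \<Rightarrow> real"
  assumes "c < d"
    and cont_A: "continuous_on {c..d} A" and cont_B: "continuous_on {c..d} B"
    and weak: "\<And>\<eta> \<eta>' \<eta>''. \<lbrakk>\<And>t. (\<eta> has_real_derivative \<eta>' t) (at t);
        \<And>t. (\<eta>' has_real_derivative \<eta>'' t) (at t); continuous_on UNIV \<eta>'';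
        \<And>t. t \<notin> {c<..<d} \<Longrightarrow> \<eta> t = 0 \<and> \<eta>' t = 0\<rbrakk>
      \<Longrightarrow> integral {c..d} (\<lambda>t. A t * \<eta> t + B t * \<eta>' t) = 0"
    and t: "t \<in> {c..d}"
  shows "(B has_real_derivative A t) (at t within {c..d})"
proof -
  define F where "F t = integral {c..t} A" for t
  have F: "(F has_real_derivative A t) (at t within {c..d})" if "t \<in> {c..d}" for t
    unfolding F_def by (rule integral_has_real_derivative[OF cont_A that])
  then have cont_F: "continuous_on {c..d} F" by (rule DERIV_continuous_on)
  define D where "D t = B t - F t" for t
  have cont_D: "continuous_on {c..d} D" unfolding D_def by (intro continuous_intros cont_B cont_F)
  have D_le: "D q \<le> D p" if p: "p \<in> {c<..<d}" and q: "q \<in> {c<..<d}" for p q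
  proof (rule ccontr)
    assume "\<not> D q \<le> D p"
    then have less: "D p < D q" by simp
    \<comment> \<open>A level strictly between the two values. It can be subtracted from
      \<open>D\<close> freely because \<eta>' has integral 0.\<close>
    define k where "k = (D p + D q) / 2"
    have k: "D p < k" "k < D q" using less by (auto simp: k_def)
    have cont_at: "isCont D s" if "s \<in> {c<..<d}" for s
      using continuous_on_interior[OF cont_D] that by simp
    have "\<forall>\<^sub>F s in nhds p. D s < k"
      using order_tendstoD(2)[OF cont_at[OF p, unfolded isCont_def tendsto_at_iff_tendsto_nhds] k(1)] .
    then obtain r1 where r1: "r1 > 0" "\<And>s. \<bar>s - p\<bar> < r1 \<Longrightarrow> D s < k"
      unfolding eventually_nhds_metric dist_real_def by auto
    have "\<forall>\<^sub>F s in nhds q. k < D s"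
      using order_tendstoD(1)[OF cont_at[OF q, unfolded isCont_def tendsto_at_iff_tendsto_nhds] k(2)] .
    then obtain r2 where r2: "r2 > 0" "\<And>s. \<bar>s - q\<bar> < r2 \<Longrightarrow> k < D s"
      unfolding eventually_nhds_metric dist_real_def by auto
    \<comment> \<open>Bumps of width 3h starting at p and q then stay inside the interval, do not
      overlap, and lie where D < k and D > k respectively.\<close>
    define h where "h = Min {r1, r2, \<bar>p - q\<bar>, d - p, d - q} / 4"
    have "p \<noteq> q" using less by auto
    then have h: "0 < h" "3 * h < r1" "3 * h < r2" "3 * h < \<bar>p - q\<bar>" "3 * h < d - p" "3 * h < d - q"
      using r1 r2 p q by (auto simp: h_def min_def)
    \<comment> \<open>The derivative is a positive bump to the right of q minus an equal one to the
      right of p. Past both bumps the two primitives share the value 6 h^3, so \<eta> vanishes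
      there.\<close>
    define \<eta> where "\<eta> t = spline 3 h (t - q) - spline 3 h (t - p)" for t
    define \<eta>' where "\<eta>' t = 3 * (spline 2 h (t - q) - spline 2 h (t - p))" for t
    define \<eta>'' where "\<eta>'' t = 6 * (spline 1 h (t - q) - spline 1 h (t - p))" for t
    have d1: "(\<eta> has_real_derivative \<eta>' t) (at t)" for t
      using spline_has_derivative[of 2 h q t] spline_has_derivative[of 2 h p t]
      by (auto simp: \<eta>_def[abs_def] \<eta>'_def eval_nat_numeral intro!: derivative_eq_intros)
    have d2: "(\<eta>' has_real_derivative \<eta>'' t) (at t)" for t
      using spline_has_derivative[of 1 h q t] spline_has_derivative[of 1 h p t]
      by (auto simp: \<eta>'_def[abs_def] \<eta>''_def eval_nat_numeral intro!: derivative_eq_intros)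
    have out: "\<eta> t = 0 \<and> \<eta>' t = 0" if "t \<notin> {c<..<d}" for t
    proof (cases "t \<le> c")
      case True
      then show ?thesis using p q h by (simp add: \<eta>_def \<eta>'_def spline_left)
    next
      case False
      then have "d \<le> t" using that by auto
      then show ?thesis using p q h by (simp add: \<eta>_def \<eta>'_def spline3_right spline2_right)
    qed
    have cont_\<eta>: "continuous_on T \<eta>" "continuous_on T \<eta>'" for T
      unfolding \<eta>_def \<eta>'_def by (intro continuous_intros continuous_on_spline)+
    have zero: "integral {c..d} (\<lambda>t. A t * \<eta> t + B t * \<eta>' t) = 0"
      by (rule weak[OF d1 d2 _ out]) (auto simp: \<eta>''_def intro!: continuous_intros continuous_on_spline)
    \<comment> \<open>Integration by parts: the primitive (F + k) \<eta> vanishes at both end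
      points. Subtracting this zero integral from \<open>zero\<close> leaves the integral of (D - k)
      \<eta>'.\<close>
    have "((\<lambda>t. (F t + k) * \<eta> t) has_vector_derivative A t * \<eta> t + (F t + k) * \<eta>' t) (at t within {c..d})"
      if "t \<in> {c..d}" for t
      unfolding has_real_derivative_iff_has_vector_derivative[symmetric]
      by (rule derivative_eq_intros F[OF that] has_field_derivative_at_within[OF d1] refl)+ simp
    from fundamental_theorem_of_calculus[OF less_imp_le[OF \<open>c < d\<close>] this]
    have "((\<lambda>t. A t * \<eta> t + (F t + k) * \<eta>' t) has_integral 0) {c..d}"
      using out[of c] out[of d] by simp
    moreover have "((\<lambda>t. A t * \<eta> t + B t * \<eta>' t) has_integral 0) {c..d}"
      unfolding zero[symmetric]
      by (intro integrable_integral integrable_continuous_real continuous_intros cont_A cont_B cont_\<eta>)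
    ultimately have "((\<lambda>t. (A t * \<eta> t + B t * \<eta>' t) - (A t * \<eta> t + (F t + k) * \<eta>' t)) has_integral 0 - 0) {c..d}"
      by (intro has_integral_diff)
    then have "((\<lambda>t. (D t - k) * \<eta>' t) has_integral 0) {c..d}"
      by (simp add: D_def algebra_simps)
    then have int0: "integral {c..d} (\<lambda>t. (D t - k) * \<eta>' t) = 0" by (rule integral_unique)
    have nonneg: "0 \<le> (D t - k) * \<eta>' t" for t
    proof -
      consider "0 < t - q" "t - q < 3 * h" | "0 < t - p" "t - p < 3 * h"
        | "\<not> (0 < t - q \<and> t - q < 3 * h)" "\<not> (0 < t - p \<and> t - p < 3 * h)" by blast
      then show ?thesis
      proof cases
        case 1
        have "t - p \<le> 0 \<or> 3 * h \<le> t - p" using 1 h by linarith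
        then have "spline 2 h (t - p) = 0" using h by (auto simp: spline_left spline2_right)
        then show ?thesis using 1 h r2(2)[of t] by (simp add: \<eta>'_def spline2_nonneg)
      next
        case 2
        have "t - q \<le> 0 \<or> 3 * h \<le> t - q" using 2 h by linarith
        then have "spline 2 h (t - q) = 0" using h by (auto simp: spline_left spline2_right)
        then show ?thesis using 2 h r1(2)[of t]
          by (simp add: \<eta>'_def spline2_nonneg mult_nonpos_nonneg)
      next
        case 3
        then have "spline 2 h (t - q) = 0" "spline 2 h (t - p) = 0"
          using h by (auto simp: not_less spline_left spline2_right)
        then show ?thesis by (simp add: \<eta>'_def)
      qed
    qed
    have cont_D\<eta>: "continuous_on {c..d} (\<lambda>t. (D t - k) * \<eta>' t)"
      by (intro continuous_intros cont_D cont_\<eta>)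
    \<comment> \<open>A continuous nonnegative function with integral 0 vanishes identically; at q +
      h, inside the positive bump, both factors are strictly positive.\<close>
    have "\<forall>t\<in>{c..d}. (D t - k) * \<eta>' t = 0"
      using integral_eq_0_iff[OF cont_D\<eta> \<open>c < d\<close> nonneg] int0 by blast
    moreover have "q + h \<in> {c..d}" using q h by auto
    moreover have "D (q + h) - k > 0" using r2(2)[of "q + h"] h by simp
    moreover have "q + h - p \<le> 0 \<or> 3 * h \<le> q + h - p" using h by linarith
    then have "spline 2 h (q + h - p) = 0" using h by (auto simp: spline_left spline2_right)
    then have "\<eta>' (q + h) > 0" using h by (simp add: \<eta>'_def spline_def)
    ultimately show False by fastforce
  qed
  \<comment> \<open>Exchanging p and q in \<open>D_le\<close> makes \<open>D\<close> constant on the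
    open interval, and continuity extends this to the end points.\<close>
  define m where "m = (c + d) / 2"
  have m: "m \<in> {c<..<d}" using \<open>c < d\<close> by (auto simp: m_def)
  have cl: "closure {c<..<d} = {c..d}" using \<open>c < d\<close> by simp
  have D: "D s = D m" if "s \<in> {c..d}" for s
    using continuous_constant_on_closure[of "{c<..<d}" D "D m" s] cont_D that
      D_le[OF _ m] D_le[OF m] unfolding cl by (meson antisym)
  have "((\<lambda>s. F s + D m) has_real_derivative A t) (at t within {c..d})"
    by (rule derivative_eq_intros F[OF t] refl)+ simp
  then show ?thesis
    by (rule has_field_derivative_transform_within[OF _ zero_less_one t]) (use D in \<open>auto simp: D_def algebra_simps\<close>)
qed

subsection \<open>First variation and Euler--Lagrange equations\<close>

text \<open>The chain rule needs \<open>L\<close> only along the range of \<open>c\<close>. A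
  derivative within \<open>S\<close> therefore yields a two-sided derivative of the composite when
  the curve stays in \<open>S\<close>.\<close>

lemma deriv_compose_curve:
  fixes c :: "real \<Rightarrow> 'a::real_normed_vector" and L :: "'a \<Rightarrow> real"
  assumes "(L has_derivative D) (at (c s) within S)" and "range c \<subseteq> S"
    and "(c has_vector_derivative e) (at s)"
  shows "deriv (\<lambda>s. L (c s)) s = D e"
proof -
  have "(L has_derivative D) (at (c s) within range c)"
    using assms(1,2) by (rule has_derivative_subset)
  from diff_chain_within[OF assms(3)[unfolded has_vector_derivative_def] this]
  have "((\<lambda>s. L (c s)) has_derivative (\<lambda>h. D (h *\<^sub>R e))) (at s)"
    by (simp add: o_def)
  moreover have "(\<lambda>h. D (h *\<^sub>R e)) = (*) (D e)"
    using has_derivative_bounded_linear[OF assms(1)]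
    by (simp add: fun_eq_iff linear_simps mult.commute)
  ultimately show ?thesis
    by (simp add: has_field_derivative_def DERIV_imp_deriv)
qed

text \<open>Lines in the slots other than time stay in \<open>T \<times> UNIV\<close>, so the
  two-sided partial derivatives agree with \<open>D\<close> even at end points of the time
  interval.\<close>

lemma partial_eq:
  assumes L: "(L has_derivative D) (at (t, x, v, y, w, z) within T \<times> UNIV)" and "t \<in> T"
  shows "partial2 L (t, x, v, y, w, z) = D (0, 1, 0, 0, 0, 0)"
    and "partial3 L (t, x, v, y, w, z) = D (0, 0, 1, 0, 0, 0)"
    and "partial4 L (t, x, v, y, w, z) = D (0, 0, 0, 1, 0, 0)"
    and "partial5 L (t, x, v, y, w, z) = D (0, 0, 0, 0, 1, 0)"
    and "partial6 L (t, x, v, y, w, z) = D (0, 0, 0, 0, 0, 1)"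
proof -
  note curve = deriv_compose_curve[where S = "T \<times> UNIV" and D = D and L = L]
  note vector_derivative_intros = has_vector_derivative_Pair has_vector_derivative_const
    has_vector_derivative_id
  show "partial2 L (t, x, v, y, w, z) = D (0, 1, 0, 0, 0, 0)"
    unfolding partial2_def prod.case
    by (rule curve) (use assms in \<open>auto intro!: vector_derivative_intros\<close>)
  show "partial3 L (t, x, v, y, w, z) = D (0, 0, 1, 0, 0, 0)"
    unfolding partial3_def prod.case
    by (rule curve) (use assms in \<open>auto intro!: vector_derivative_intros\<close>)
  show "partial4 L (t, x, v, y, w, z) = D (0, 0, 0, 1, 0, 0)"
    unfolding partial4_def prod.case
    by (rule curve) (use assms in \<open>auto intro!: vector_derivative_intros\<close>)
  show "partial5 L (t, x, v, y, w, z) = D (0, 0, 0, 0, 1, 0)"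
    unfolding partial5_def prod.case
    by (rule curve) (use assms in \<open>auto intro!: vector_derivative_intros\<close>)
  show "partial6 L (t, x, v, y, w, z) = D (0, 0, 0, 0, 0, 1)"
    unfolding partial6_def prod.case
    by (rule curve) (use assms in \<open>auto intro!: vector_derivative_intros\<close>)
qed

text \<open>Since \<open>s\<close> takes both signs, a quantity of constant sign cannot have a
  nonzero linear part. Here \<open>v\<close> stands for the gap between the perturbed and the
  optimal final value, available only for small \<open>s\<close>.\<close>

lemma first_order_condition:
  fixes J :: real
  assumes "0 < c"
    and "\<And>\<epsilon>. 0 < \<epsilon> \<Longrightarrow> \<exists>\<delta>>0. \<forall>s. \<bar>s\<bar> < \<delta> \<longrightarrow> (\<exists>v\<ge>0. \<bar>c * v - s * J\<bar> \<le> \<epsilon> * \<bar>s\<bar>)"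
  shows "J = 0"
proof (rule ccontr)
  assume "J \<noteq> 0"
  then obtain \<delta> where "0 < \<delta>"
    and \<delta>: "\<And>s. \<bar>s\<bar> < \<delta> \<Longrightarrow> \<exists>v\<ge>0. \<bar>c * v - s * J\<bar> \<le> \<bar>J\<bar> / 2 * \<bar>s\<bar>"
    using assms(2)[of "\<bar>J\<bar> / 2"] by auto
  \<comment> \<open>With the sign opposite to \<open>J\<close>, the linear part is - |J| \<delta> /
    2 while the error is at most |J| \<delta> / 4, so \<open>c * v\<close> would be
    negative.\<close>
  define s where "s = - sgn J * \<delta> / 2"
  have s: "\<bar>s\<bar> = \<delta> / 2" "s * J = - \<bar>J\<bar> * \<delta> / 2"
    using \<open>0 < \<delta>\<close> \<open>J \<noteq> 0\<close> by (auto simp: s_def abs_mult abs_sgn_eq sgn_if)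
  then obtain v where "0 \<le> v" "\<bar>c * v + \<bar>J\<bar> * \<delta> / 2\<bar> \<le> \<bar>J\<bar> * \<delta> / 4"
    using \<delta>[of s] \<open>0 < \<delta>\<close> by auto
  moreover have "0 \<le> c * v" using \<open>0 < c\<close> \<open>0 \<le> v\<close> by simp
  moreover have "0 < \<bar>J\<bar> * \<delta>" using \<open>0 < \<delta>\<close> \<open>J \<noteq> 0\<close> by simp
  ultimately show False by linarith
qed

text \<open>The integral is the first-order coefficient of the final Herglotz value along x + s
  \<eta>, scaled by the discount at \<open>b\<close>. The variation lives on the whole line so that
  delayed values make sense; its vanishing up to \<open>a\<close> preserves the initial
  history.\<close>

lemma first_variation:
  assumes "a < b" and "0 \<le> \<tau>" and L: "C1_on L ({a..b} \<times> UNIV)"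
    and sol: "solution_P a b \<tau> \<beta> \<gamma> \<delta> L x" and z: "herglotz_ivp a b \<tau> \<gamma> L x z"
    and \<eta>': "\<And>t. (\<eta> has_real_derivative \<eta>' t) (at t)"
    and \<eta>'': "\<And>t. (\<eta>' has_real_derivative \<eta>'' t) (at t)" and cont_\<eta>'': "continuous_on UNIV \<eta>''"
    and \<eta>_init: "\<And>t. t \<le> a \<Longrightarrow> \<eta> t = 0" and \<eta>_b: "\<eta> b = 0"
  defines "p \<equiv> delay_path a b \<tau> x z"
  shows "integral {a..b} (\<lambda>t. discount a b \<tau> L x z t *
    (partial2 L (p t) * \<eta> t + partial3 L (p t) * \<eta>' t
      + partial4 L (p t) * \<eta> (t - \<tau>) + partial5 L (p t) * \<eta>' (t - \<tau>))) = 0"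
proof -
  let ?S = "{a..b} \<times> (UNIV :: (real \<times> real \<times> real \<times> real \<times> real) set)" and ?I = "{a - \<tau>..b}"
  have lt: "a - \<tau> < b" using \<open>a < b\<close> \<open>0 \<le> \<tau>\<close> by simp
  obtain L' where L': "\<And>q. q \<in> ?S \<Longrightarrow> (L has_derivative blinfun_apply (L' q)) (at q within ?S)"
    and cont_L': "continuous_on ?S L'"
    using L unfolding C1_on_def by blast
  have adm: "admissible a b \<tau> \<beta> \<delta> x" using sol by (simp add: solution_P_def)
  then obtain x' x'' where x': "\<And>t. t \<in> ?I \<Longrightarrow> (x has_real_derivative x' t) (at t within ?I)"
    and x'': "\<And>t. t \<in> ?I \<Longrightarrow> (x' has_real_derivative x'' t) (at t within ?I)"
    and cont_x'': "continuous_on ?I x''"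
    unfolding admissible_def C2_on_def by blast
  have cont_x: "continuous_on ?I x" "continuous_on ?I x'"
    using DERIV_continuous_on[OF x'] DERIV_continuous_on[OF x''] by blast+
  have z': "(z has_real_derivative L (p t)) (at t within {a..b})" if "t \<in> {a..b}" for t
    using z that by (simp add: herglotz_ivp_def p_def)
  have cont_z: "continuous_on {a..b} z" using z' by (rule DERIV_continuous_on)
  define d where "d t = (0::real, \<eta> t, \<eta>' t, \<eta> (t - \<tau>), \<eta>' (t - \<tau>), 0::real)" for t
  define e where "e = (0::real, 0::real, 0::real, 0::real, 0::real, 1::real)"
  have vd: "vector_derivative f (at t within ?I) = f' t"
    if "\<And>t. t \<in> ?I \<Longrightarrow> (f has_real_derivative f' t) (at t within ?I)" "t \<in> ?I" for f f' t
    using that(1)[OF that(2)] vector_derivative_within_closed_interval[OF lt that(2)]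
    by (simp add: has_real_derivative_iff_has_vector_derivative)
  have in_I: "t \<in> ?I" "t - \<tau> \<in> ?I" if "t \<in> {a..b}" for t
    using that \<open>0 \<le> \<tau>\<close> by auto
  define y where "y s t = x t + s * \<eta> t" for s t
  have y': "(y s has_real_derivative x' t + s * \<eta>' t) (at t within ?I)" if "t \<in> ?I" for s t
    unfolding y_def using x'[OF that] has_field_derivative_at_within[OF \<eta>']
    by (auto intro!: derivative_eq_intros)
  have y'': "((\<lambda>t. x' t + s * \<eta>' t) has_real_derivative x'' t + s * \<eta>'' t) (at t within ?I)"
    if "t \<in> ?I" for s t
    using x''[OF that] has_field_derivative_at_within[OF \<eta>''] by (auto intro!: derivative_eq_intros)
  have vd_x: "vector_derivative x (at t within ?I) = x' t" if "t \<in> ?I" for t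
    by (rule vd[where f' = x']) (use x' that in auto)
  have vd_y: "vector_derivative (y s) (at t within ?I) = x' t + s * \<eta>' t" if "t \<in> ?I" for s t
    by (rule vd[where f' = "\<lambda>t. x' t + s * \<eta>' t"]) (use y' that in auto)
  have p_eq: "p t = (t, x t, x' t, x (t - \<tau>), x' (t - \<tau>), z t)" if "t \<in> {a..b}" for t
    using vd_x[OF in_I(1)[OF that]] vd_x[OF in_I(2)[OF that]] by (simp add: p_def delay_path_def)
  \<comment> \<open>The perturbed path is affine in \<open>s\<close> and in the change w - z of the
    Herglotz variable, which is the form treated by \<open>perturbed_ivp\<close>.\<close>
  have path_eq: "delay_path a b \<tau> (y s) w t = p t + s *\<^sub>R d t + (w t - z t) *\<^sub>R e"
    if "t \<in> {a..b}" for s w t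
    using vd_y[OF in_I(1)[OF that], of s] vd_y[OF in_I(2)[OF that], of s] p_eq[OF that]
    by (simp add: delay_path_def d_def e_def y_def)
  have adm_y: "admissible a b \<tau> \<beta> \<delta> (y s)" for s
  proof -
    have "C2_on (y s) ?I"
      unfolding C2_on_def
      using y' y'' by (intro exI[of _ "\<lambda>t. x' t + s * \<eta>' t"] exI[of _ "\<lambda>t. x'' t + s * \<eta>'' t"])
        (auto intro!: continuous_intros cont_x'' continuous_on_subset[OF cont_\<eta>''])
    then show ?thesis using adm \<eta>_init \<eta>_b by (auto simp: admissible_def y_def)
  qed
  have p_in: "p t \<in> ?S" if "t \<in> {a..b}" for t
    using p_eq[OF that] that by simp
  have in_S: "p t + s *\<^sub>R d t + r *\<^sub>R e \<in> ?S" if "t \<in> {a..b}" for t s r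
    using p_eq[OF that] that by (simp add: d_def e_def)
  have cont_shift: "continuous_on {a..b} (\<lambda>t. f (t - \<tau>))" if "continuous_on ?I f" for f :: "real \<Rightarrow> real"
    by (rule continuous_on_compose2[OF that]) (use in_I \<open>0 \<le> \<tau>\<close> in \<open>auto intro!: continuous_intros\<close>)
  have cont_x_ab: "continuous_on {a..b} x" "continuous_on {a..b} x'"
    using in_I(1) by (auto intro!: continuous_on_subset[OF cont_x(1)] continuous_on_subset[OF cont_x(2)])
  have "continuous_on {a..b} (\<lambda>t. (t, x t, x' t, x (t - \<tau>), x' (t - \<tau>), z t))"
    by (intro continuous_intros cont_x_ab cont_shift cont_x cont_z)
  then have cont_p: "continuous_on {a..b} p"
    by (rule continuous_on_eq) (simp add: p_eq)
  have cont_\<eta>: "continuous_on T \<eta>" "continuous_on T \<eta>'" for T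
    using DERIV_continuous_on[OF has_field_derivative_at_within[OF \<eta>']]
      DERIV_continuous_on[OF has_field_derivative_at_within[OF \<eta>'']] by blast+
  have cont_d: "continuous_on {a..b} d"
    unfolding d_def by (intro continuous_intros cont_shift cont_\<eta>)
  have partials: "partial2 L (p t) = L' (p t) (0, 1, 0, 0, 0, 0)"
      "partial3 L (p t) = L' (p t) (0, 0, 1, 0, 0, 0)" "partial4 L (p t) = L' (p t) (0, 0, 0, 1, 0, 0)"
      "partial5 L (p t) = L' (p t) (0, 0, 0, 0, 1, 0)" "partial6 L (p t) = L' (p t) e"
    if "t \<in> {a..b}" for t
    using partial_eq[OF L'[OF p_in[OF that], unfolded p_eq[OF that]] that]
    by (simp_all add: p_eq[OF that] e_def)
  define l where "l t = exp (- integral {a..t} (\<lambda>\<theta>. L' (p \<theta>) e))" for t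
  have l_eq: "discount a b \<tau> L x z t = l t" if "t \<in> {a..b}" for t
    unfolding discount_def l_def p_def[symmetric]
    using partials(5) that by (intro arg_cong[where f = exp] arg_cong[where f = uminus] integral_cong) auto
  define J where "J = integral {a..b} (\<lambda>t. l t * L' (p t) (d t))"
  have J_eq: "J = integral {a..b} (\<lambda>t. discount a b \<tau> L x z t *
    (partial2 L (p t) * \<eta> t + partial3 L (p t) * \<eta>' t
      + partial4 L (p t) * \<eta> (t - \<tau>) + partial5 L (p t) * \<eta>' (t - \<tau>)))"
    unfolding J_def
  proof (rule integral_cong)
    fix t assume t: "t \<in> {a..b}"
    have "d t = \<eta> t *\<^sub>R (0, 1, 0, 0, 0, 0) + \<eta>' t *\<^sub>R (0, 0, 1, 0, 0, 0)
        + \<eta> (t - \<tau>) *\<^sub>R (0, 0, 0, 1, 0, 0) + \<eta>' (t - \<tau>) *\<^sub>R (0, 0, 0, 0, 1, 0)"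
      by (simp add: d_def)
    then have "L' (p t) (d t) = partial2 L (p t) * \<eta> t + partial3 L (p t) * \<eta>' t
        + partial4 L (p t) * \<eta> (t - \<tau>) + partial5 L (p t) * \<eta>' (t - \<tau>)"
      by (simp only: partials[OF t] blinfun.add_right blinfun.scaleR_right) (simp add: mult.commute)
    then show "l t * L' (p t) (d t) = discount a b \<tau> L x z t *
        (partial2 L (p t) * \<eta> t + partial3 L (p t) * \<eta>' t
          + partial4 L (p t) * \<eta> (t - \<tau>) + partial5 L (p t) * \<eta>' (t - \<tau>))"
      by (simp add: l_eq[OF t])
  qed
  have perturbed: "\<exists>\<delta>>0. \<forall>s. \<bar>s\<bar> < \<delta> \<longrightarrow> (\<exists>w. herglotz_ivp a b \<tau> \<gamma> L (y s) w \<and>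
      \<bar>l b * (w b - z b) - s * J\<bar> \<le> \<epsilon> * \<bar>s\<bar>)" if "0 < \<epsilon>" for \<epsilon>
  proof -
    obtain \<delta> where "0 < \<delta>" and \<delta>: "\<And>s. \<bar>s\<bar> < \<delta> \<Longrightarrow> \<exists>u. u a = 0 \<and>
        (\<forall>t\<in>{a..b}. (u has_real_derivative L (p t + s *\<^sub>R d t + u t *\<^sub>R e) - L (p t)) (at t within {a..b})) \<and>
        \<bar>l b * u b - s * J\<bar> \<le> \<epsilon> * \<bar>s\<bar>"
      unfolding l_def J_def
      by (rule perturbed_ivp[OF \<open>a < b\<close> _ _ L' cont_L' cont_p cont_d in_S \<open>0 < \<epsilon>\<close>])
        (auto intro!: closed_Times convex_Times)
    have "\<exists>w. herglotz_ivp a b \<tau> \<gamma> L (y s) w \<and> \<bar>l b * (w b - z b) - s * J\<bar> \<le> \<epsilon> * \<bar>s\<bar>"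
      if "\<bar>s\<bar> < \<delta>" for s
    proof -
      from \<delta>[OF that] obtain u where u: "u a = 0" "\<bar>l b * u b - s * J\<bar> \<le> \<epsilon> * \<bar>s\<bar>"
        and u': "\<And>t. t \<in> {a..b} \<Longrightarrow>
          (u has_real_derivative L (p t + s *\<^sub>R d t + u t *\<^sub>R e) - L (p t)) (at t within {a..b})"
        by blast
      have "herglotz_ivp a b \<tau> \<gamma> L (y s) (\<lambda>t. z t + u t)"
        unfolding herglotz_ivp_def
      proof (intro conjI ballI)
        fix t assume t: "t \<in> {a..b}"
        show "((\<lambda>t. z t + u t) has_real_derivative L (delay_path a b \<tau> (y s) (\<lambda>t. z t + u t) t))
            (at t within {a..b})"
          using DERIV_add[OF z'[OF t] u'[OF t]] by (simp add: path_eq[OF t])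
      qed (use z u in \<open>simp add: herglotz_ivp_def\<close>)
      then show ?thesis using u(2) by (intro exI[of _ "\<lambda>t. z t + u t"]) simp
    qed
    with \<open>0 < \<delta>\<close> show ?thesis by blast
  qed
  have "0 < l b" by (simp add: l_def)
  from sol consider "minimizes_P a b \<tau> \<beta> \<gamma> \<delta> L x" | "maximizes_P a b \<tau> \<beta> \<gamma> \<delta> L x"
    by (auto simp: solution_P_def)
  then have "J = 0"
  proof cases
    case 1
    then have le: "0 \<le> w b - z b" if "herglotz_ivp a b \<tau> \<gamma> L (y s) w" for s w
      using z adm_y that unfolding minimizes_P_def by fastforce
    show ?thesis
      by (rule first_order_condition[OF \<open>0 < l b\<close>]) (use perturbed le in meson)
  next
    case 2
    then have le: "0 \<le> z b - w b" if "herglotz_ivp a b \<tau> \<gamma> L (y s) w" for s w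
      using z adm_y that unfolding maximizes_P_def by fastforce
    \<comment> \<open>A maximizer reverses the sign of the gap, so the first-order condition is
      applied to - J.\<close>
    have flip: "\<bar>l b * (z b - w b) - s * (- J)\<bar> = \<bar>l b * (w b - z b) - s * J\<bar>" for w s
      by (simp add: algebra_simps abs_if)
    have "- J = 0"
      by (rule first_order_condition[OF \<open>0 < l b\<close>]) (use perturbed le flip in metis)
    then show ?thesis by simp
  qed
  then show ?thesis using J_eq by simp
qed

section \<open>Localization of the first variation and the two Euler--Lagrange equations\<close>

lemma integral_subinterval_eq:
  fixes f :: "real \<Rightarrow> real"
  assumes "{c..d} \<subseteq> {a..b}" and "\<And>t. t \<in> {a..b} \<Longrightarrow> t \<notin> {c..d} \<Longrightarrow> f t = 0"
  shows "integral {a..b} f = integral {c..d} f"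
proof -
  have "integral {a..b} f = integral {a..b} (\<lambda>t. if t \<in> {c..d} then f t else 0)"
    using assms(2) by (intro integral_cong) auto
  also have "\<dots> = integral ({c..d} \<inter> {a..b}) f" by (rule integral_restrict_Int)
  also have "{c..d} \<inter> {a..b} = {c..d}" using assms(1) by blast
  finally show ?thesis .
qed

theorem theorem3p3:
  fixes a b \<tau> \<beta> \<gamma> :: real
    and \<delta> x z :: "real \<Rightarrow> real"
    and L :: "point \<Rightarrow> real"
  assumes "a < b" and "0 \<le> \<tau>" and "\<tau> < b - a"
    and "C2_on \<delta> {a - \<tau>..a}"
    and "C1_on L ({a..b} \<times> UNIV)"
    and "\<And>y w P. \<lbrakk>admissible a b \<tau> \<beta> \<delta> y; herglotz_ivp a b \<tau> \<gamma> L y w;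
            P \<in> {partial2 L, partial3 L, partial4 L, partial5 L, partial6 L}\<rbrakk>
          \<Longrightarrow> (\<lambda>t. P (delay_path a b \<tau> y w t)) differentiable_on {a..b}"
    and "solution_P a b \<tau> \<beta> \<gamma> \<delta> L x"
    and "herglotz_ivp a b \<tau> \<gamma> L x z"
  shows "let p = delay_path a b \<tau> x z; l = discount a b \<tau> L x z in
      (\<forall>t\<in>{a..b - \<tau>}.
         l (t + \<tau>) *
           (partial4 L (p (t + \<tau>))
            - vector_derivative (\<lambda>s. partial5 L (p (s + \<tau>))) (at t within {a..b - \<tau>})
            + partial5 L (p (t + \<tau>)) * partial6 L (p (t + \<tau>)))
         + l t *
           (partial2 L (p t)
            - vector_derivative (\<lambda>s. partial3 L (p s)) (at t within {a..b})
            + partial3 L (p t) * partial6 L (p t)) = 0) \<and>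
      (0 < \<tau> \<longrightarrow> (\<forall>t\<in>{b - \<tau>..b}.
         partial2 L (p t)
         - vector_derivative (\<lambda>s. partial3 L (p s)) (at t within {a..b})
         + partial3 L (p t) * partial6 L (p t) = 0))"
proof -
  define p where "p = delay_path a b \<tau> x z"
  define l where "l = discount a b \<tau> L x z"
  define G2 where "G2 t = partial2 L (p t)" for t
  define G3 where "G3 t = partial3 L (p t)" for t
  define G4 where "G4 t = partial4 L (p t)" for t
  define G5 where "G5 t = partial5 L (p t)" for t
  define G6 where "G6 t = partial6 L (p t)" for t
  note G_defs = G2_def G3_def G4_def G5_def G6_def
  define G3' where "G3' t = vector_derivative G3 (at t within {a..b})" for t
  define G5' where "G5' t = vector_derivative (\<lambda>s. G5 (s + \<tau>)) (at t within {a..b - \<tau>})" for t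
  note \<tau> = \<open>0 \<le> \<tau>\<close> \<open>\<tau> < b - a\<close>
  have adm: "admissible a b \<tau> \<beta> \<delta> x" using assms(7) by (simp add: solution_P_def)
  have diff: "G2 differentiable_on {a..b}" "G3 differentiable_on {a..b}"
    "G4 differentiable_on {a..b}" "G5 differentiable_on {a..b}" "G6 differentiable_on {a..b}"
    using assms(6)[OF adm assms(8)] unfolding G_defs[abs_def] p_def by blast+
  note cont_G = diff[THEN differentiable_imp_continuous_on]
  have G3': "(G3 has_real_derivative G3' t) (at t within {a..b})" if "t \<in> {a..b}" for t
    using diff(2) that
    unfolding differentiable_on_def G3'_def has_real_derivative_iff_has_vector_derivative
    by (simp add: vector_derivative_works)
  \<comment> \<open>The chain rule runs through the image [a + \<tau>, b] of the shift, so at t = a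
    the derivative of \<open>G5\<close> at a + \<tau> is taken from the right.\<close>
  have G5': "((\<lambda>s. G5 (s + \<tau>)) has_real_derivative G5' t) (at t within {a..b - \<tau>})"
    if "t \<in> {a..b - \<tau>}" for t
  proof -
    have image: "(\<lambda>s. s + \<tau>) ` {a..b - \<tau>} \<subseteq> {a..b}" using \<tau> by auto
    have "G5 differentiable (at (t + \<tau>) within (\<lambda>s. s + \<tau>) ` {a..b - \<tau>})"
      using diff(4) that image \<tau> unfolding differentiable_on_def
      by (intro differentiable_within_subset[OF _ image]) auto
    then have "G5 \<circ> (\<lambda>s. s + \<tau>) differentiable (at t within {a..b - \<tau>})"
      by (intro differentiable_chain_within) auto
    then show ?thesis
      unfolding G5'_def has_real_derivative_iff_has_vector_derivative o_def
      by (simp add: vector_derivative_works)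
  qed
  have l_deriv: "(l has_real_derivative - G6 t * l t) (at t within {a..b})" if "t \<in> {a..b}" for t
  proof -
    define I where "I t = integral {a..t} G6" for t
    have "(I has_real_derivative G6 t) (at t within {a..b})"
      unfolding I_def by (rule integral_has_real_derivative[OF cont_G(5) that])
    moreover have "l = (\<lambda>t. exp (- I t))"
      by (simp add: fun_eq_iff l_def discount_def I_def G6_def[abs_def] p_def)
    ultimately show ?thesis by (auto intro!: derivative_eq_intros)
  qed
  have l_pos: "0 < l t" for t by (simp add: l_def discount_def)
  have cont_l: "continuous_on {a..b} l" using l_deriv by (rule DERIV_continuous_on)
  have shift: "t + \<tau> \<in> {a..b}" "t \<in> {a..b}" if "t \<in> {a..b - \<tau>}" for t using that \<tau> by auto
  have cont_shift: "continuous_on {a..b - \<tau>} (\<lambda>t. f (t + \<tau>))" if "continuous_on {a..b} f"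
    for f :: "real \<Rightarrow> real"
    by (rule continuous_on_compose2[OF that]) (use shift \<tau> in \<open>auto intro!: continuous_intros\<close>)
  have l_shift_deriv: "((\<lambda>t. l (t + \<tau>)) has_real_derivative - G6 (t + \<tau>) * l (t + \<tau>)) (at t within {a..b - \<tau>})"
    if "t \<in> {a..b - \<tau>}" for t
  proof -
    have "(l has_real_derivative - G6 (t + \<tau>) * l (t + \<tau>)) (at (t + \<tau>) within (\<lambda>s. s + \<tau>) ` {a..b - \<tau>})"
      using \<tau> by (intro DERIV_subset[OF l_deriv[OF shift(1)[OF that]]]) auto
    moreover have "((\<lambda>s. s + \<tau>) has_real_derivative 1) (at t within {a..b - \<tau>})"
      by (auto intro!: derivative_eq_intros)
    ultimately show ?thesis
      using DERIV_image_chain by (fastforce simp: o_def)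
  qed

  \<comment> \<open>The integrand of the first variation is split into its undelayed part
    \<open>f\<close> and its delayed part \<open>g\<close>, to be localized separately.\<close>
  define f where "f \<eta> \<eta>' t = l t * G2 t * \<eta> t + l t * G3 t * \<eta>' t" for \<eta> \<eta>' :: "real \<Rightarrow> real" and t
  define g where "g \<eta> \<eta>' t = l t * G4 t * \<eta> (t - \<tau>) + l t * G5 t * \<eta>' (t - \<tau>)"
    for \<eta> \<eta>' :: "real \<Rightarrow> real" and t
  have variation: "integral {a..b} (f \<eta> \<eta>') + integral {a..b} (g \<eta> \<eta>') = 0"
    and cont_fg: "continuous_on {a..b} (f \<eta> \<eta>')" "continuous_on {a..b} (g \<eta> \<eta>')"
    if \<eta>: "\<And>t. (\<eta> has_real_derivative \<eta>' t) (at t)" "\<And>t. (\<eta>' has_real_derivative \<eta>'' t) (at t)"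
      "continuous_on UNIV \<eta>''" "\<And>t. t \<notin> {a<..<b} \<Longrightarrow> \<eta> t = 0" for \<eta> \<eta>' \<eta>''
  proof -
    have "continuous_on UNIV \<eta>" "continuous_on UNIV \<eta>'"
      using \<eta>(1,2) by (auto intro!: DERIV_continuous_on)
    then have cont: "continuous_on {a..b} (\<lambda>t. \<eta> (h t))" "continuous_on {a..b} (\<lambda>t. \<eta>' (h t))"
      if "continuous_on {a..b} h" for h
      using that by (auto intro: continuous_on_compose2)
    show c: "continuous_on {a..b} (f \<eta> \<eta>')" "continuous_on {a..b} (g \<eta> \<eta>')"
      unfolding f_def g_def by (intro continuous_intros cont_l cont_G cont)+
    have "integral {a..b} (\<lambda>t. f \<eta> \<eta>' t + g \<eta> \<eta>' t) = 0"
      using first_variation[OF assms(1,2,5,7,8) \<eta>(1-3)] \<eta>(4)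
      by (simp add: f_def g_def l_def G_defs p_def algebra_simps)
    then show "integral {a..b} (f \<eta> \<eta>') + integral {a..b} (g \<eta> \<eta>') = 0"
      by (simp add: integral_add integrable_continuous_real c)
  qed

  have first: "l (t + \<tau>) * (G4 (t + \<tau>) - G5' t + G5 (t + \<tau>) * G6 (t + \<tau>))
      + l t * (G2 t - G3' t + G3 t * G6 t) = 0" if t: "t \<in> {a..b - \<tau>}" for t
  proof -
    \<comment> \<open>Coefficients of \<eta> and \<eta>' after the substitution t + \<tau> for t in
      the delayed part, which brings both parts to [a, b - \<tau>].\<close>
    define A where "A t = l t * G2 t + l (t + \<tau>) * G4 (t + \<tau>)" for t
    define B where "B t = l t * G3 t + l (t + \<tau>) * G5 (t + \<tau>)" for t
    have lt: "a < b - \<tau>" using \<tau> by simp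
    have sub: "{a..b - \<tau>} \<subseteq> {a..b}" using \<tau> by auto
    note cont = continuous_on_subset[OF _ sub]
    have "(B has_real_derivative A t) (at t within {a..b - \<tau>})"
    proof (rule du_bois_reymond[OF lt _ _ _ t])
      show "continuous_on {a..b - \<tau>} A" "continuous_on {a..b - \<tau>} B"
        unfolding A_def B_def by (intro continuous_intros cont cont_shift cont_l cont_G)+
      fix \<eta> \<eta>' \<eta>'' :: "real \<Rightarrow> real"
      assume \<eta>: "\<And>t. (\<eta> has_real_derivative \<eta>' t) (at t)" "\<And>t. (\<eta>' has_real_derivative \<eta>'' t) (at t)"
        "continuous_on UNIV \<eta>''" and out: "\<And>t. t \<notin> {a<..<b - \<tau>} \<Longrightarrow> \<eta> t = 0 \<and> \<eta>' t = 0"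
      have "\<And>t. t \<notin> {a<..<b} \<Longrightarrow> \<eta> t = 0" using out \<tau> by force
      note var = variation[OF \<eta> this] and c = cont_fg[OF \<eta> this]
      have f: "integral {a..b} (f \<eta> \<eta>') = integral {a..b - \<tau>} (f \<eta> \<eta>')"
        by (rule integral_subinterval_eq[OF sub]) (use out in \<open>auto simp: f_def\<close>)
      \<comment> \<open>For t below a + \<tau> the delayed argument lies below \<open>a\<close>,
        where the test function and its derivative vanish.\<close>
      have "integral {a..b} (g \<eta> \<eta>') = integral {a + \<tau>..b} (g \<eta> \<eta>')"
        by (rule integral_subinterval_eq) (use out \<tau> in \<open>auto simp: g_def\<close>)
      also have "\<dots> = integral {a..b - \<tau>} (\<lambda>t. g \<eta> \<eta>' (t + \<tau>))"
        using integral_shift_real_ivl[of "a + \<tau>" \<tau> b "g \<eta> \<eta>'"] by simp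
      finally have "integral {a..b - \<tau>} (f \<eta> \<eta>') + integral {a..b - \<tau>} (\<lambda>t. g \<eta> \<eta>' (t + \<tau>)) = 0"
        using var f by simp
      moreover have "(f \<eta> \<eta>') integrable_on {a..b - \<tau>}" "(\<lambda>t. g \<eta> \<eta>' (t + \<tau>)) integrable_on {a..b - \<tau>}"
        using integrable_continuous_real[OF cont[OF c(1)]] integrable_continuous_real[OF cont_shift[OF c(2)]]
        by blast+
      ultimately have "integral {a..b - \<tau>} (\<lambda>t. f \<eta> \<eta>' t + g \<eta> \<eta>' (t + \<tau>)) = 0"
        by (simp add: integral_add)
      then show "integral {a..b - \<tau>} (\<lambda>t. A t * \<eta> t + B t * \<eta>' t) = 0"
        by (simp add: f_def g_def A_def B_def algebra_simps)
    qed
    \<comment> \<open>The product rule with l' = - G6 l gives a second expression for the derivative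
      of \<open>B\<close>; uniqueness of derivatives on a nondegenerate interval equates it with
      \<open>A\<close>.\<close>
    moreover have "(B has_real_derivative (- G6 t * l t * G3 t + l t * G3' t)
        + (- G6 (t + \<tau>) * l (t + \<tau>) * G5 (t + \<tau>) + l (t + \<tau>) * G5' t)) (at t within {a..b - \<tau>})"
      unfolding B_def
      using DERIV_subset[OF l_deriv[OF shift(2)[OF t]] sub] DERIV_subset[OF G3'[OF shift(2)[OF t]] sub]
        l_shift_deriv[OF t] G5'[OF t]
      by (auto intro!: derivative_eq_intros simp: algebra_simps)
    ultimately have "A t = (- G6 t * l t * G3 t + l t * G3' t)
        + (- G6 (t + \<tau>) * l (t + \<tau>) * G5 (t + \<tau>) + l (t + \<tau>) * G5' t)"
      using vector_derivative_within_closed_interval[OF lt t]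
      unfolding has_real_derivative_iff_has_vector_derivative by metis
    then show ?thesis by (simp add: A_def algebra_simps)
  qed

  have second: "G2 t - G3' t + G3 t * G6 t = 0" if "0 < \<tau>" and t: "t \<in> {b - \<tau>..b}" for t
  proof -
    have lt: "b - \<tau> < b" using \<open>0 < \<tau>\<close> by simp
    have sub: "{b - \<tau>..b} \<subseteq> {a..b}" using \<tau> by auto
    note cont = continuous_on_subset[OF _ sub]
    have t': "t \<in> {a..b}" using t sub by blast
    have "((\<lambda>t. l t * G3 t) has_real_derivative l t * G2 t) (at t within {b - \<tau>..b})"
    proof (rule du_bois_reymond[OF lt _ _ _ t])
      show "continuous_on {b - \<tau>..b} (\<lambda>t. l t * G2 t)" "continuous_on {b - \<tau>..b} (\<lambda>t. l t * G3 t)"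
        by (intro continuous_intros cont cont_l cont_G)+
      fix \<eta> \<eta>' \<eta>'' :: "real \<Rightarrow> real"
      assume \<eta>: "\<And>t. (\<eta> has_real_derivative \<eta>' t) (at t)" "\<And>t. (\<eta>' has_real_derivative \<eta>'' t) (at t)"
        "continuous_on UNIV \<eta>''" and out: "\<And>t. t \<notin> {b - \<tau><..<b} \<Longrightarrow> \<eta> t = 0 \<and> \<eta>' t = 0"
      have "\<And>t. t \<notin> {a<..<b} \<Longrightarrow> \<eta> t = 0" using out \<tau> by force
      note var = variation[OF \<eta> this]
      have f: "integral {a..b} (f \<eta> \<eta>') = integral {b - \<tau>..b} (f \<eta> \<eta>')"
        by (rule integral_subinterval_eq[OF sub]) (use out in \<open>auto simp: f_def\<close>)
      \<comment> \<open>The delayed argument never exceeds b - \<tau>, and the test function is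
        supported to the right of that point, so the delayed part disappears and a single factor
        \<open>l t\<close> remains to be cancelled.\<close>
      have "integral {a..b} (g \<eta> \<eta>') = integral {a..b} (\<lambda>_. 0)"
        by (rule integral_cong) (use out in \<open>auto simp: g_def\<close>)
      then show "integral {b - \<tau>..b} (\<lambda>t. l t * G2 t * \<eta> t + l t * G3 t * \<eta>' t) = 0"
        using var f by (simp add: f_def[abs_def])
    qed
    moreover have "((\<lambda>t. l t * G3 t) has_real_derivative - G6 t * l t * G3 t + l t * G3' t)
        (at t within {b - \<tau>..b})"
      using DERIV_subset[OF l_deriv[OF t'] sub] DERIV_subset[OF G3'[OF t'] sub]
      by (auto intro!: derivative_eq_intros simp: algebra_simps)
    ultimately have "l t * G2 t = - G6 t * l t * G3 t + l t * G3' t"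
      using vector_derivative_within_closed_interval[OF lt t]
      unfolding has_real_derivative_iff_has_vector_derivative by metis
    then have "l t * (G2 t - G3' t + G3 t * G6 t) = 0" by (simp add: algebra_simps)
    then show ?thesis using l_pos[of t] by simp
  qed
  show ?thesis
    using first second
    unfolding Let_def G3'_def G5'_def G_defs[abs_def] p_def l_def by blast
qed

end
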